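(* Let $n\ge 2$. Assume that the softmax map $\mathbb{R}^n\to\Delta$ is Lipschitz continuous with respect to the Euclidean norm, and let $S\subset\Delta$ be a set of probability vectors on which the Shannon entropy $H$ is Lipschitz continuous with respect to the Euclidean norm. Then there exists a constant $L>0$ such that for all $\theta_b,\theta_s\in\mathbb{R}^n$ and every binary mask $M\in\{0,1\}^n$, setting $\theta_f=\theta_b+M\odot(\theta_s-\theta_b)$, $q=\mathrm{softmax}(\theta_b)$ and $q_f=\mathrm{softmax}(\theta_f)$, if $q,q_f\in S$ then $$H(q_f)\ \ge\ H(q)-L\cdot\big\|M\odot(\theta_s-\theta_b)\big\|_2 .$$
   Context: $\Delta$ is the set of probability vectors in $\mathbb{R}^n$; $\mathrm{softmax}(v)_i=e^{v_i}/\sum_j e^{v_j}$; $H(r)=-\sum_i r_i\log r_i$ is the Shannon entropy (with $0\log 0=0$); $\odot$ is the entrywise product. $\theta_b$ and $\theta_s$ are the base and secondary model parameters, $\theta_f$ the fused parameters, and $q$, $q_f$ the output distributions of the base and fused models. *)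

theory Defs
  imports "HOL-Analysis.Analysis"
begin

definition prob_simplex :: "(real ^ 'n) set" where
  "prob_simplex = {r. (\<forall>i. 0 \<le> r $ i) \<and> (\<Sum>i\<in>UNIV. r $ i) = 1}"

definition softmax :: "real ^ 'n \<Rightarrow> real ^ 'n" where
  "softmax v = (\<chi> i. exp (v $ i) / (\<Sum>j\<in>UNIV. exp (v $ j)))"

text \<open>Entropy in nats. A zero entry contributes \<open>0 * ln 0 = 0\<close>, in agreement with
  the usual convention for \<open>0 log 0\<close>.\<close>

definition shannon_entropy :: "real ^ 'n \<Rightarrow> real" where
  "shannon_entropy r = - (\<Sum>i\<in>UNIV. r $ i * ln (r $ i))"

definition binary_masks :: "(real ^ 'n) set" where
  "binary_masks = {M. \<forall>i. M $ i \<in> {0, 1}}"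

text \<open>The product \<open>*\<close> on \<open>real ^ 'n\<close> is the library's entrywise product.\<close>

definition fuse :: "real ^ 'n \<Rightarrow> real ^ 'n \<Rightarrow> real ^ 'n \<Rightarrow> real ^ 'n" where
  "fuse M \<theta>b \<theta>s = \<theta>b + M * (\<theta>s - \<theta>b)"

lemma softmax_in_prob_simplex: "softmax v \<in> prob_simplex"
proof -
  have "(\<Sum>j\<in>UNIV. exp (v $ j)) > 0"
    by (intro sum_pos) auto
  then show ?thesis
    by (auto simp: prob_simplex_def softmax_def simp flip: sum_divide_distrib)
qed

end

theory Submission
  imports Defs
begin

text \<open>Entropy after softmax is a composition of Lipschitz maps. Fusing moves
  \<open>\<theta>b\<close> by exactly \<open>M * (\<theta>s - \<theta>b)\<close>, so softmax outputs
  differ by at most \<open>C\<close> times its norm, and entropies by at most \<open>D * C\<close>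
  times it. Membership of both outputs in \<open>S\<close> matters for the second factor: the slope
  of \<open>- x * ln x\<close> blows up at 0, so entropy is not Lipschitz on the whole
  simplex.\<close>

theorem theorem3p2:
  fixes S :: "(real ^ 'n) set"
  assumes "CARD('n) \<ge> 2"
    and "\<exists>C. C-lipschitz_on UNIV (softmax :: real ^ 'n \<Rightarrow> real ^ 'n)"
    and "S \<subseteq> prob_simplex"
    and "\<exists>C. C-lipschitz_on S shannon_entropy"
  shows "\<exists>L>0. \<forall>(\<theta>b :: real ^ 'n) \<theta>s. \<forall>M\<in>binary_masks.
    let \<theta>f = fuse M \<theta>b \<theta>s; q = softmax \<theta>b; qf = softmax \<theta>f in
      q \<in> S \<longrightarrow> qf \<in> S \<longrightarrow>
        shannon_entropy qf \<ge> shannon_entropy q - L * norm (M * (\<theta>s - \<theta>b))"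
proof -
  obtain C D where C: "C-lipschitz_on UNIV (softmax :: real ^ 'n \<Rightarrow> real ^ 'n)"
    and D: "D-lipschitz_on S shannon_entropy"
    using assms(2,4) by blast
  have nonneg: "C \<ge> 0" "D \<ge> 0"
    using C D by (auto dest: lipschitz_on_nonneg)
  \<comment> \<open>The witness is \<open>D * C + 1\<close>: the product alone may vanish
    (\<open>D = 0\<close> is possible when \<open>S\<close> is a singleton), while \<open>L\<close>
    must be strictly positive.\<close>
  have "shannon_entropy (softmax (fuse M \<theta>b \<theta>s))
      \<ge> shannon_entropy (softmax \<theta>b) - (D * C + 1) * norm (M * (\<theta>s - \<theta>b))"
    if q: "softmax \<theta>b \<in> S" and qf: "softmax (fuse M \<theta>b \<theta>s) \<in> S" for M \<theta>b \<theta>s :: "real ^ 'n"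
  proof -
    have "dist (shannon_entropy (softmax \<theta>b)) (shannon_entropy (softmax (fuse M \<theta>b \<theta>s)))
        \<le> D * dist (softmax \<theta>b) (softmax (fuse M \<theta>b \<theta>s))"
      using D q qf by (rule lipschitz_onD)
    also have "\<dots> \<le> D * (C * dist \<theta>b (fuse M \<theta>b \<theta>s))"
      using nonneg by (intro mult_left_mono lipschitz_onD[OF C]) auto
    also have "\<dots> = D * C * norm (M * (\<theta>s - \<theta>b))"
      by (simp add: fuse_def dist_norm)
    also have "\<dots> \<le> (D * C + 1) * norm (M * (\<theta>s - \<theta>b))"
      by (intro mult_right_mono) auto
    \<comment> \<open>The chain bounds the absolute entropy change; only the bound on a decrease is
      kept.\<close>
    finally show ?thesis
      by (simp add: dist_real_def)
  qed
  moreover have "D * C + 1 > 0"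
    using nonneg by (simp add: add_nonneg_pos)
  ultimately show ?thesis
    unfolding Let_def by blast
qed

end
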